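(* Let $P=(p_{ij})$ be an irreducible stochastic transition matrix on $X=\mathbb{Z}_+=\{0,1,2,\dots\}$ with $p_{ij}=0$ whenever $j-i\geq2$. For $0\leq i<n$ put $p_n^{(i)}=\sum_{k=0}^{i}p_{nk}$, and define inductively $$F_n^{(n)}=1,\qquad F_n^{(i)}=\sum_{k=i}^{n-1}\frac{p_n^{(k)}F_k^{(i)}}{p_{n,n+1}},\quad 0\le i<n.$$ Set $$\sigma_1=\sup_{n\geq0}\ \sum_{k=0}^{n}\frac{1}{p_{k,k+1}F_k^{(0)}}\ \sum_{j=n}^{\infty}F_j^{(0)}.$$ If $\sigma_1<\infty$, then the Markov chain with transition matrix $P$ is geometrically transient.
   Context: $P^n(i,A)=\sum_{j\in A}p^{(n)}_{ij}$ denotes the $n$-step transition probabilities. Irreducible means every state can be reached from every state (so $p_{n,n+1}>0$ for all $n$); in this case a maximal irreducibility measure $\psi$ is counting measure, up to equivalence, and $\mathcal{B}^+(X)$ is the family of nonempty subsets of $X$. In the definition of $\sigma_1$ the product is of the two sums $\sum_{k=0}^n \frac{1}{p_{k,k+1}F_k^{(0)}}$ and $\sum_{j=n}^\infty F_j^{(0)}$, and the convention $1/0=+\infty$ is used. Geometric transience: a set $A\in\mathcal{B}^{+}(X)$ is called uniformly geometric transient if there is a constant $\kappa>1$ with $\sup_{x\in A}\sum_{n=1}^{\infty}\kappa^{n}P^{n}(x,A)<\infty$. The chain is geometrically transient if it is $\psi$-irreducible and there exist sets $D$ and $A_i$, $i=1,2,\dots$ with $X=D\cup\bigcup_{i=1}^{\infty}A_i$,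 $\psi(D)=0$ (here: $D=\emptyset$), and each $A_i$ uniformly geometric transient. *)

theory Defs
  imports "HOL-Analysis.Analysis"
begin

definition stochastic_matrix :: "('a \<Rightarrow> 'a \<Rightarrow> real) \<Rightarrow> bool" where
  "stochastic_matrix P \<longleftrightarrow> (\<forall>i j. 0 \<le> P i j) \<and> (\<forall>i. (P i has_sum 1) UNIV)"

primrec nstep :: "('a \<Rightarrow> 'a \<Rightarrow> real) \<Rightarrow> nat \<Rightarrow> 'a \<Rightarrow> 'a \<Rightarrow> real" where
  "nstep P 0 i j = (if i = j then 1 else 0)"
| "nstep P (Suc n) i j = (\<Sum>\<^sub>\<infinity>k. P i k * nstep P n k j)"

definition nstep_set :: "('a \<Rightarrow> 'a \<Rightarrow> real) \<Rightarrow> nat \<Rightarrow> 'a \<Rightarrow> 'a set \<Rightarrow> real" where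
  "nstep_set P n i A = (\<Sum>\<^sub>\<infinity>j\<in>A. nstep P n i j)"

definition irreducible_matrix :: "('a \<Rightarrow> 'a \<Rightarrow> real) \<Rightarrow> bool" where
  "irreducible_matrix P \<longleftrightarrow> (\<forall>i j. \<exists>n. nstep P n i j > 0)"

(* The series is taken in ennreal, so it has a value in [0, \<infinity>] even when it diverges. *)
definition uniformly_geometric_transient :: "('a \<Rightarrow> 'a \<Rightarrow> real) \<Rightarrow> 'a set \<Rightarrow> bool" where
  "uniformly_geometric_transient P A \<longleftrightarrow> A \<noteq> {} \<and>
     (\<exists>\<kappa>::real. \<kappa> > 1 \<and>
        (SUP x\<in>A. \<Sum>n. ennreal (\<kappa> ^ Suc n * nstep_set P (Suc n) x A)) < \<infinity>)"

(* On a countable state space, the maximal irreducibility measure of an irreducible chain is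
   counting measure, up to equivalence: psi-irreducibility is irreducibility, the sets of
   positive measure are the nonempty ones, and psi(D) = 0 means D = {}. *)
definition geometrically_transient :: "('a::countable \<Rightarrow> 'a \<Rightarrow> real) \<Rightarrow> bool" where
  "geometrically_transient P \<longleftrightarrow> irreducible_matrix P \<and>
     (\<exists>D A. (UNIV :: 'a set) = D \<union> (\<Union>i::nat. A i) \<and>
        emeasure (count_space UNIV) D = 0 \<and>
        (\<forall>i. uniformly_geometric_transient P (A i)))"

definition lower_sum :: "(nat \<Rightarrow> nat \<Rightarrow> real) \<Rightarrow> nat \<Rightarrow> nat \<Rightarrow> real" where
  "lower_sum P i n = (\<Sum>k=0..i. P n k)"

(* F_seq P i n is F_n^(i). It is only meaningful for i <= n; for n < i the sum is empty
   and the value is 0. *)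
fun F_seq :: "(nat \<Rightarrow> nat \<Rightarrow> real) \<Rightarrow> nat \<Rightarrow> nat \<Rightarrow> real" where
  "F_seq P i n =
     (if n = i then 1
      else (\<Sum>k=i..<n. lower_sum P k n * F_seq P i k / P n (Suc n)))"

declare F_seq.simps [simp del]

(* In ennreal, 1 / 0 = \<infinity>. *)
definition sigma1 :: "(nat \<Rightarrow> nat \<Rightarrow> real) \<Rightarrow> ennreal" where
  "sigma1 P =
     (SUP n. (\<Sum>k=0..n. 1 / ennreal (P k (Suc k) * F_seq P 0 k)) *
             (\<Sum>j. ennreal (F_seq P 0 (n + j))))"

end

theory Submission imports Defs begin

text \<open>
  A positive function \<open>V\<close> with \<open>P V \<le> r V\<close> and \<open>r < 1\<close> forces \<open>P\<^sup>n(i, {i}) \<le> r\<^sup>n\<close>, so every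
  singleton is uniformly geometrically transient. Write \<open>F\<^sub>j\<close> for \<open>F_seq P 0 j\<close>, and let \<open>\<Phi>\<^sub>n\<close>
  and \<open>h\<^sub>n\<close> be the two sums in the definition of \<open>\<sigma>\<^sub>1\<close>, so that \<open>\<Phi>\<^sub>n h\<^sub>n \<le> \<sigma>\<^sub>1\<close>. As \<open>h\<close> is harmonic off \<open>0\<close>, the function
  \<open>V n = (\<Sum>j\<ge>n. F\<^sub>j sqrt \<Phi>\<^sub>j)\<close> satisfies \<open>P V - V \<le> - 1 / (2 sqrt \<Phi>\<^sub>n)\<close>, while
  \<open>F\<^sub>j / sqrt h\<^sub>j \<le> 2 (sqrt h\<^sub>j - sqrt h\<^sub>j\<^sub>+\<^sub>1)\<close> telescopes to \<open>V n \<le> 2 \<sigma>\<^sub>1 / sqrt \<Phi>\<^sub>n\<close>.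
  Hence \<open>r = 1 - 1 / (4 \<sigma>\<^sub>1)\<close> works.
\<close>

section \<open>Multi-step transition probabilities and closed sets\<close>

lemma nstep_nonneg:
  assumes "\<And>i j. 0 \<le> P i j"
  shows "0 \<le> nstep P n i j"
  by (induction n arbitrary: i) (auto intro!: infsum_nonneg mult_nonneg_nonneg assms)

lemma nstep_closed_set:
  assumes "\<And>i j. i \<in> C \<Longrightarrow> j \<notin> C \<Longrightarrow> P i j = 0" and "i \<in> C" "j \<notin> C"
  shows "nstep P n i j = 0"
  using assms(2)
proof (induction n arbitrary: i)
  case 0
  then show ?case using assms(3) by auto
next
  case (Suc n)
  have "P i k * nstep P n k j = 0" for k
    using Suc assms(1) by (cases "k \<in> C") auto
  then show ?case unfolding nstep.simps by (intro infsum_0)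
qed

text \<open>A closed set traps the chain, so none can be both proper and nonempty. Positivity of the
  up-steps and of \<open>F\<close> is proved by exhibiting such a set.\<close>

lemma irreducible_closed_set:
  assumes "irreducible_matrix P" and "\<And>i j. i \<in> C \<Longrightarrow> j \<notin> C \<Longrightarrow> P i j = 0"
    and "i \<in> C"
  shows "j \<in> C"
proof (rule ccontr)
  assume "j \<notin> C"
  moreover obtain n where "nstep P n i j > 0"
    using assms(1) unfolding irreducible_matrix_def by blast
  ultimately show False using nstep_closed_set[of C P i j n] assms by simp
qed

section \<open>Skip-free rows and geometric decay from superharmonic functions\<close>

lemma infsum_skip_free:
  fixes g :: "nat \<Rightarrow> real"
  assumes "\<And>j. j \<ge> i + 2 \<Longrightarrow> P i j = 0"
  shows "(\<Sum>\<^sub>\<infinity>k. P i k * g k) = (\<Sum>k\<le>Suc i. P i k * g k)"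
proof -
  have "(\<Sum>\<^sub>\<infinity>k. P i k * g k) = (\<Sum>\<^sub>\<infinity>k\<in>{..Suc i}. P i k * g k)"
    by (rule infsum_cong_neutral) (auto simp: assms)
  then show ?thesis by simp
qed

lemma row_sum_skip_free:
  fixes P :: "nat \<Rightarrow> nat \<Rightarrow> real"
  assumes "stochastic_matrix P" and "\<And>j. j \<ge> i + 2 \<Longrightarrow> P i j = 0"
  shows "(\<Sum>k\<le>Suc i. P i k) = 1"
proof -
  have "(\<Sum>\<^sub>\<infinity>k. P i k) = 1"
    using assms(1) unfolding stochastic_matrix_def by (blast intro: infsumI)
  then show ?thesis using infsum_skip_free[of i P "\<lambda>_. 1"] assms(2) by simp
qed

text \<open>Iterating \<open>P V \<le> r V\<close> gives a bound on the whole sum over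
  \<open>j\<close>; the induction keeps a single \<open>j\<close>, so that only the finite one-step
  sums occur.\<close>

lemma nstep_superharmonic:
  fixes P :: "nat \<Rightarrow> nat \<Rightarrow> real"
  assumes "\<And>i j. 0 \<le> P i j" and "\<And>i j. j \<ge> i + 2 \<Longrightarrow> P i j = 0"
    and "\<And>i. 0 \<le> V i" and "0 \<le> r" and "\<And>i. (\<Sum>k\<le>Suc i. P i k * V k) \<le> r * V i"
  shows "nstep P n i j * V j \<le> r ^ n * V i"
proof (induction n arbitrary: i)
  case 0
  then show ?case using assms(3) by auto
next
  case (Suc n)
  have "nstep P (Suc n) i j * V j = (\<Sum>k\<le>Suc i. P i k * (nstep P n k j * V j))"
    using infsum_skip_free[of i P "\<lambda>k. nstep P n k j"] assms(2)
    by (simp add: sum_distrib_right mult.assoc del: sum.atMost_Suc)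
  also have "\<dots> \<le> (\<Sum>k\<le>Suc i. P i k * (r ^ n * V k))"
    by (intro sum_mono mult_left_mono Suc assms)
  also have "\<dots> = r ^ n * (\<Sum>k\<le>Suc i. P i k * V k)"
    unfolding sum_distrib_left by (rule sum.cong) auto
  also have "\<dots> \<le> r ^ n * (r * V i)"
    by (intro mult_left_mono assms zero_le_power)
  finally show ?case by (simp add: mult_ac)
qed

lemma geometrically_transient_if_superharmonic:
  fixes P :: "nat \<Rightarrow> nat \<Rightarrow> real"
  assumes "\<And>i j. 0 \<le> P i j" and "irreducible_matrix P"
    and "\<And>i j. j \<ge> i + 2 \<Longrightarrow> P i j = 0"
    and V: "\<And>i. 0 < V i" and r: "r < 1" "\<And>i. (\<Sum>k\<le>Suc i. P i k * V k) \<le> r * V i"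
  shows "geometrically_transient P"
proof -
  have "0 \<le> (\<Sum>k\<le>Suc 0. P 0 k * V k)"
    by (intro sum_nonneg mult_nonneg_nonneg assms less_imp_le)
  also have "\<dots> \<le> r * V 0" by (rule r)
  finally have r0: "0 \<le> r" using V[of 0] by (simp add: zero_le_mult_iff)
  \<comment> \<open>Any \<open>\<kappa> > 1\<close> with \<open>\<kappa> * r < 1\<close> serves;
    this choice also covers \<open>r = 0\<close>.\<close>
  define \<kappa> where "\<kappa> = 2 / (1 + r)"
  have k1: "\<kappa> > 1" and k0: "0 \<le> \<kappa> * r" and kr: "\<kappa> * r < 1"
    using r0 r by (auto simp: \<kappa>_def field_simps)
  have "uniformly_geometric_transient P {i}" for i
  proof -
    have "nstep P n i i \<le> r ^ n" for n
    proof -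
      have "nstep P n i i * V i \<le> r ^ n * V i"
        using assms r0 by (intro nstep_superharmonic) (auto intro: less_imp_le)
      then show ?thesis using V[of i] by simp
    qed
    then have le: "\<kappa> ^ Suc n * nstep_set P (Suc n) i {i} \<le> (\<kappa> * r) ^ Suc n" for n
      using k1 unfolding nstep_set_def power_mult_distrib
      by (simp del: power_Suc nstep.simps)
    have sm: "summable (\<lambda>n. (\<kappa> * r) ^ Suc n)"
      using k0 kr by (subst summable_Suc_iff) (simp add: summable_geometric)
    have "(\<Sum>n. ennreal (\<kappa> ^ Suc n * nstep_set P (Suc n) i {i}))
        \<le> (\<Sum>n. ennreal ((\<kappa> * r) ^ Suc n))"
      by (intro suminf_le ennreal_leI le) auto
    also have "\<dots> = ennreal (\<Sum>n. (\<kappa> * r) ^ Suc n)"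
      by (rule suminf_ennreal2[OF _ sm]) (rule zero_le_power[OF k0])
    also have "\<dots> < \<infinity>" by simp
    finally show ?thesis
      unfolding uniformly_geometric_transient_def using k1 by auto
  qed
  then have "(UNIV :: nat set) = {} \<union> (\<Union>i. {i}) \<and> emeasure (count_space UNIV) ({} :: nat set) = 0 \<and>
      (\<forall>i. uniformly_geometric_transient P {i})"
    by auto
  then show ?thesis
    unfolding geometrically_transient_def using assms(2) by blast
qed

section \<open>Drift by summation by parts, and a Hardy-type tail bound\<close>

lemma summation_by_parts_lower_sum:
  fixes V w :: "nat \<Rightarrow> real"
  assumes "\<And>j. V j = w j + V (Suc j)"
  shows "(\<Sum>k<m. P n k * (V k - V m)) = (\<Sum>j<m. lower_sum P j n * w j)"
proof (induction m)
  case (Suc m)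
  \<comment> \<open>Moving the base point from \<open>m\<close> to \<open>Suc m\<close> adds
    \<open>w m\<close> to every difference, and the old term at \<open>k = m\<close> is
    zero.\<close>
  have "(\<Sum>k<Suc m. P n k * (V k - V (Suc m)))
      = (\<Sum>k<Suc m. P n k * (V k - V m) + P n k * w m)"
    using assms[of m] by (intro sum.cong refl) (simp add: algebra_simps)
  also have "\<dots> = (\<Sum>k<m. P n k * (V k - V m)) + (\<Sum>k<Suc m. P n k) * w m"
    by (simp add: sum.distrib sum_distrib_right distrib_right)
  also have "(\<Sum>k<Suc m. P n k) = lower_sum P m n"
    by (simp add: lower_sum_def atLeast0AtMost lessThan_Suc_atMost)
  finally show ?case using Suc by simp
qed simp

text \<open>Since the row sums to 1, \<open>V\<close> may be centred at \<open>V (Suc n)\<close> and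
  summed by parts. The term at \<open>j = n\<close> has weight \<open>1 - P n (Suc n)\<close>, and
  its part \<open>w n\<close> turns \<open>V (Suc n)\<close> into \<open>V n\<close>.\<close>

lemma skip_free_drift:
  fixes V w :: "nat \<Rightarrow> real"
  assumes "(\<Sum>k\<le>Suc n. P n k) = 1" and V: "\<And>j. V j = w j + V (Suc j)"
  shows "(\<Sum>k\<le>Suc n. P n k * V k)
    = V n + (\<Sum>j<n. lower_sum P j n * w j) - P n (Suc n) * w n"
proof -
  have "(\<Sum>k\<le>Suc n. P n k * V k)
      = (\<Sum>k\<le>Suc n. P n k * (V k - V (Suc n))) + (\<Sum>k\<le>Suc n. P n k) * V (Suc n)"
    by (simp only: sum_distrib_right right_diff_distrib sum_subtractf diff_add_cancel)
  also have "(\<Sum>k\<le>Suc n. P n k * (V k - V (Suc n))) = (\<Sum>j<Suc n. lower_sum P j n * w j)"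
    unfolding summation_by_parts_lower_sum[where V = V and w = w, OF V, symmetric]
    by (simp add: lessThan_Suc_atMost)
  finally have "(\<Sum>k\<le>Suc n. P n k * V k)
      = (\<Sum>j<n. lower_sum P j n * w j) + lower_sum P n n * w n + V (Suc n)"
    by (simp add: assms(1) del: sum.atMost_Suc)
  moreover have "lower_sum P n n = 1 - P n (Suc n)"
    using assms(1) by (simp add: lower_sum_def atLeast0AtMost)
  ultimately show ?thesis using V[of n] by (simp add: left_diff_distrib)
qed

text \<open>The hypothesis enters twice: termwise, to replace \<open>sqrt (\<Phi> j)\<close> by
  \<open>sqrt (\<sigma> / h j)\<close> and make the sum telescope, and once more at
  \<open>n\<close>, to turn the resulting \<open>sqrt (h n)\<close> into
  \<open>sqrt (\<sigma> / \<Phi> n)\<close>.\<close>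

lemma Hardy_tail_bound:
  fixes F \<Phi> :: "nat \<Rightarrow> real"
  assumes F: "\<And>j. 0 < F j" "summable F" and \<Phi>: "\<And>n. 0 < \<Phi> n"
    and \<sigma>: "\<And>n. \<Phi> n * (\<Sum>j. F (n + j)) \<le> \<sigma>"
  shows "summable (\<lambda>j. F j * sqrt (\<Phi> j))"
    and "(\<Sum>j. F (n + j) * sqrt (\<Phi> (n + j))) \<le> 2 * \<sigma> / sqrt (\<Phi> n)"
proof -
  define h where "h n = (\<Sum>j. F (n + j))" for n
  have sF: "summable (\<lambda>j. F (n + j))" for n
    using F(2) by (simp add: summable_iff_shift add.commute)
  have hpos: "0 < h n" for n
    unfolding h_def using F sF by (intro suminf_pos) auto
  have hrec: "h n = F n + h (Suc n)" for n
    using suminf_split_head[OF sF[of n]] by (simp add: h_def)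
  have s0: "0 < \<sigma>"
    using mult_pos_pos[OF \<Phi>[of 0] hpos[of 0]] \<sigma>[of 0] by (simp add: h_def)
  have le: "F j * sqrt (\<Phi> j) \<le> 2 * sqrt \<sigma> * (sqrt (h j) - sqrt (h (Suc j)))" for j
  proof -
    have mono: "sqrt (h (Suc j)) \<le> sqrt (h j)" using hrec[of j] F(1)[of j] by simp
    have "F j = (sqrt (h j) - sqrt (h (Suc j))) * (sqrt (h j) + sqrt (h (Suc j)))"
      using hrec[of j] hpos[of j] hpos[of "Suc j"] by (simp add: algebra_simps)
    also have "\<dots> \<le> (sqrt (h j) - sqrt (h (Suc j))) * (2 * sqrt (h j))"
      using mono by (intro mult_left_mono) auto
    finally have "F j * sqrt (\<Phi> j)
        \<le> 2 * (sqrt (h j) - sqrt (h (Suc j))) * (sqrt (h j) * sqrt (\<Phi> j))"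
      using \<Phi>[of j] by (auto dest!: mult_right_mono[where c = "sqrt (\<Phi> j)"] simp: mult_ac)
    also have "\<dots> \<le> 2 * (sqrt (h j) - sqrt (h (Suc j))) * sqrt \<sigma>"
      using mono \<sigma>[of j]
      by (intro mult_left_mono) (auto simp: h_def mult.commute simp flip: real_sqrt_mult)
    finally show ?thesis by (simp add: mult_ac)
  qed
  have part: "(\<Sum>j<m. F (n + j) * sqrt (\<Phi> (n + j))) \<le> 2 * sqrt \<sigma> * sqrt (h n)" for n m
  proof -
    have "(\<Sum>j<m. F (n + j) * sqrt (\<Phi> (n + j)))
        \<le> (\<Sum>j<m. 2 * sqrt \<sigma> * (sqrt (h (n + j)) - sqrt (h (n + Suc j))))"
      using le by (intro sum_mono) simp
    also have "\<dots> = 2 * sqrt \<sigma> * (sqrt (h n) - sqrt (h (n + m)))"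
      using sum_lessThan_telescope'[of "\<lambda>j. sqrt (h (n + j))" m]
      by (simp flip: sum_distrib_left)
    also have "\<dots> \<le> 2 * sqrt \<sigma> * sqrt (h n)"
      using s0 hpos[of "n + m"] by (intro mult_left_mono) auto
    finally show ?thesis .
  qed
  have sm: "summable (\<lambda>j. F (n + j) * sqrt (\<Phi> (n + j)))" for n
    by (rule summableI_nonneg_bounded[OF _ part]) (simp add: F(1) \<Phi> less_imp_le)
  from sm[of 0] show "summable (\<lambda>j. F j * sqrt (\<Phi> j))" by simp
  have "(\<Sum>j. F (n + j) * sqrt (\<Phi> (n + j))) \<le> 2 * sqrt \<sigma> * sqrt (h n)"
    by (rule suminf_le_const[OF sm part])
  also have "sqrt (h n) \<le> sqrt (\<sigma> / \<Phi> n)"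
    using \<sigma>[of n] \<Phi>[of n] by (simp add: h_def field_simps)
  then have "2 * sqrt \<sigma> * sqrt (h n) \<le> 2 * sqrt \<sigma> * sqrt (\<sigma> / \<Phi> n)"
    using s0 by (intro mult_left_mono) auto
  also have "\<dots> = 2 * \<sigma> / sqrt (\<Phi> n)"
    using s0 by (simp add: real_sqrt_divide)
  finally show "(\<Sum>j. F (n + j) * sqrt (\<Phi> (n + j))) \<le> 2 * \<sigma> / sqrt (\<Phi> n)" .
qed

section \<open>The sequence \<open>F\<close> and its positivity\<close>

lemma F_seq_self [simp]: "F_seq P i i = 1"
  by (subst F_seq.simps) simp

text \<open>This is the recursion with the division cleared. By \<open>skip_free_drift\<close> with
  \<open>w = F\<close>, it makes the tail sums of a summable \<open>F\<close> harmonic at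
  \<open>n\<close>. It fails at \<open>n = 0\<close>, where the left side is empty.\<close>

lemma lower_sum_F_seq:
  assumes "0 < n" "P n (Suc n) \<noteq> 0"
  shows "(\<Sum>k<n. lower_sum P k n * F_seq P 0 k) = P n (Suc n) * F_seq P 0 n"
  using assms by (subst (2) F_seq.simps) (simp add: atLeast0LessThan flip: sum_divide_distrib)

lemma F_seq_nonneg:
  assumes "\<And>i j. 0 \<le> P i j"
  shows "0 \<le> F_seq P i n"
proof (induction n rule: less_induct)
  case (less n)
  then show ?case
    by (subst F_seq.simps)
      (auto simp: lower_sum_def assms intro!: sum_nonneg divide_nonneg_nonneg mult_nonneg_nonneg)
qed

text \<open>Longer upward jumps are excluded, so a zero up-step from \<open>n\<close> would close
  \<open>{..n}\<close>.\<close>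

lemma up_step_pos:
  fixes P :: "nat \<Rightarrow> nat \<Rightarrow> real"
  assumes "\<And>i j. 0 \<le> P i j" and "irreducible_matrix P"
    and "\<And>i j. j \<ge> i + 2 \<Longrightarrow> P i j = 0"
  shows "0 < P n (Suc n)"
proof (rule ccontr)
  assume "\<not> 0 < P n (Suc n)"
  with assms(1)[of n "Suc n"] have "P n (Suc n) = 0" by linarith
  then have "P i j = 0" if "i \<in> {..n}" "j \<notin> {..n}" for i j
    using that assms(3)[of i j] by (cases "i = n \<and> j = Suc n") auto
  from irreducible_closed_set[of P "{..n}", OF assms(2) this, of n "Suc n"]
  show False by simp
qed

lemma sigma1_bound:
  "(\<Sum>k=0..n. 1 / ennreal (P k (Suc k) * F_seq P 0 k)) * (\<Sum>j. ennreal (F_seq P 0 (n + j)))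
     \<le> sigma1 P"
  unfolding sigma1_def by (rule SUP_upper) simp

text \<open>
  A zero of \<open>F\<close> makes the first factor of \<open>\<sigma>\<^sub>1\<close> infinite, so \<open>\<sigma>\<^sub>1 < \<infinity>\<close> forces the tail sum to
  vanish; the chain could then never return below the first zero.
\<close>

lemma F_seq_pos:
  fixes P :: "nat \<Rightarrow> nat \<Rightarrow> real"
  assumes nonneg: "\<And>i j. 0 \<le> P i j" and irred: "irreducible_matrix P"
    and up: "\<And>n. 0 < P n (Suc n)" and fin: "sigma1 P < \<infinity>"
  shows "0 < F_seq P 0 n"
proof (rule ccontr)
  assume "\<not> 0 < F_seq P 0 n"
  then have ex: "F_seq P 0 n = 0" using F_seq_nonneg[of P 0 n] nonneg by fastforce
  define k where "k = (LEAST k. F_seq P 0 k = 0)"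
  have k: "F_seq P 0 k = 0" unfolding k_def using ex by (rule LeastI)
  have below: "F_seq P 0 j \<noteq> 0" if "j < k" for j using not_less_Least that k_def by blast
  have "k \<noteq> 0" using k by (intro notI) simp
  then obtain m where m: "k = Suc m" by (cases k) auto
  have "(\<Sum>i=0..k. 1 / ennreal (P i (Suc i) * F_seq P 0 i)) = top"
    by (simp add: sum.last_plus k)
  moreover have "(\<Sum>i=0..k. 1 / ennreal (P i (Suc i) * F_seq P 0 i)) *
      (\<Sum>j. ennreal (F_seq P 0 (k + j))) < top"
    using order.strict_trans1[OF sigma1_bound fin] by simp
  ultimately have "(\<Sum>j. ennreal (F_seq P 0 (k + j))) = 0"
    by (metis ennreal_top_mult less_irrefl)
  then have "ennreal (F_seq P 0 (k + j)) = 0" for j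
    by (subst (asm) suminf_eq_zero_iff) auto
  then have tail: "F_seq P 0 j = 0" if "k \<le> j" for j
    using F_seq_nonneg[of P 0 j] nonneg le_Suc_ex[OF that]
    by (auto simp: ennreal_eq_0_iff intro: antisym)
  have "P i j = 0" if ij: "i \<in> {k..}" "j \<notin> {k..}" for i j
  proof -
    \<comment> \<open>As \<open>F\<close> vanishes at \<open>i\<close>, so does each nonnegative
      term of its recursion. At \<open>l = m\<close>, the last index before the first zero, this
      leaves no mass of row \<open>i\<close> below \<open>k\<close>.\<close>
    have "(\<Sum>l<i. lower_sum P l i * F_seq P 0 l) = 0"
      using ij m up[of i] by (subst lower_sum_F_seq) (auto simp: tail)
    then have "lower_sum P m i * F_seq P 0 m = 0"
      using ij m
      by (subst (asm) sum_nonneg_eq_0_iff)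
        (auto intro!: mult_nonneg_nonneg sum_nonneg F_seq_nonneg nonneg simp: lower_sum_def)
    then have "(\<Sum>l=0..m. P i l) = 0" using below[of m] m by (simp add: lower_sum_def)
    then show ?thesis
      using ij m by (subst (asm) sum_nonneg_eq_0_iff) (auto simp: nonneg)
  qed
  from irreducible_closed_set[of P "{k..}", OF irred this, of k 0]
  show False using \<open>k \<noteq> 0\<close> by simp
qed

section \<open>Real form of the bound by \<open>\<sigma>\<close> and the drift estimate\<close>

theorem theorem4p5:
  fixes P :: "nat \<Rightarrow> nat \<Rightarrow> real"
  assumes "stochastic_matrix P"
    and "irreducible_matrix P"
    and "\<And>i j. j \<ge> i + 2 \<Longrightarrow> P i j = 0"
    and "sigma1 P < \<infinity>"
  shows "geometrically_transient P"
proof -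
  have nonneg: "0 \<le> P i j" for i j
    using assms(1) by (simp add: stochastic_matrix_def)
  have up: "0 < P n (Suc n)" for n by (rule up_step_pos[OF nonneg assms(2,3)])
  define F where "F = F_seq P 0"
  have F: "0 < F n" for n
    unfolding F_def by (rule F_seq_pos[OF nonneg assms(2) up assms(4)])
  define u where "u k = 1 / (P k (Suc k) * F k)" for k
  have u: "0 < u k" for k using up F by (simp add: u_def)
  \<comment> \<open>Shifted by one, so that \<open>\<Phi> 0 = 0\<close> and the drift estimate below also covers state \<open>0\<close>.\<close>
  define \<Phi> where "\<Phi> n = (\<Sum>k<n. u k)" for n
  have \<Phi>: "0 < \<Phi> (Suc n)" for n
    unfolding \<Phi>_def using u by (simp add: add_nonneg_pos sum_nonneg less_imp_le)
  define \<sigma> where "\<sigma> = enn2real (sigma1 P)"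
  have \<sigma>: "ennreal \<sigma> = sigma1 P" using assms(4) by (simp add: \<sigma>_def)
  have bound: "ennreal (\<Phi> (Suc n)) * (\<Sum>j. ennreal (F (n + j))) \<le> ennreal \<sigma>" for n
  proof -
    have "(\<Sum>k=0..n. 1 / ennreal (P k (Suc k) * F_seq P 0 k)) = (\<Sum>k=0..n. ennreal (u k))"
      using up F by (intro sum.cong refl) (simp add: u_def F_def divide_ennreal flip: ennreal_1)
    also have "\<dots> = ennreal (\<Phi> (Suc n))"
      using u by (subst sum_ennreal)
        (auto simp: \<Phi>_def atLeast0AtMost lessThan_Suc_atMost less_imp_le)
    finally show ?thesis using sigma1_bound[of P n] by (simp add: F_def \<sigma>)
  qed
  have sF: "summable F"
  proof (rule summable_suminf_not_top)
    show "(\<Sum>j. ennreal (F j)) \<noteq> top"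
    proof
      assume "(\<Sum>j. ennreal (F j)) = top"
      then show False using bound[of 0] \<Phi>[of 0] by (simp add: ennreal_mult_top top_unique)
    qed
  qed (simp add: F less_imp_le)
  have sF': "summable (\<lambda>j. F (n + j))" for n
    using sF by (simp add: summable_iff_shift add.commute)
  have Hardy: "\<Phi> (Suc n) * (\<Sum>j. F (n + j)) \<le> \<sigma>" for n
  proof -
    have "(\<Sum>j. ennreal (F (n + j))) = ennreal (\<Sum>j. F (n + j))"
      by (rule suminf_ennreal2[OF _ sF']) (simp add: F less_imp_le)
    then show ?thesis
      using bound[of n] \<Phi>[of n]
      by (simp add: \<sigma>_def flip: ennreal_mult')
  qed
  have s0: "0 < \<sigma>"
    using Hardy[of 0] mult_pos_pos[OF \<Phi>[of 0] suminf_pos[OF sF' F, of 0]] by simp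
  \<comment> \<open>The shift in \<open>\<Phi>\<close> makes \<open>\<Phi> (Suc j)\<close> the first
    factor at index \<open>j\<close> in \<open>sigma1\<close>.\<close>
  define w where "w j = F j * sqrt (\<Phi> (Suc j))" for j
  define V where "V n = (\<Sum>j. w (n + j))" for n
  have wpos: "0 < w j" for j using F \<Phi> by (simp add: w_def)
  have sw: "summable w"
    unfolding w_def using Hardy_tail_bound(1)[of F "\<lambda>n. \<Phi> (Suc n)", OF F sF \<Phi> Hardy] .
  have sw': "summable (\<lambda>j. w (n + j))" for n
    using sw by (simp add: summable_iff_shift add.commute)
  have V: "0 < V n" for n
    unfolding V_def by (rule suminf_pos[OF sw' wpos])
  have Vrec: "V n = w n + V (Suc n)" for n
    using suminf_split_head[OF sw'[of n]] by (simp add: V_def)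
  have Vle: "V n \<le> 2 * \<sigma> / sqrt (\<Phi> (Suc n))" for n
    unfolding V_def w_def
    using Hardy_tail_bound(2)[of F "\<lambda>n. \<Phi> (Suc n)", OF F sF \<Phi> Hardy] .
  have drift: "(\<Sum>k\<le>Suc n. P n k * V k) \<le> (1 - 1 / (4 * \<sigma>)) * V n" for n
  proof -
    define s t where "s = sqrt (\<Phi> (Suc n))" and "t = sqrt (\<Phi> n)"
    have \<Phi>n: "0 \<le> \<Phi> n" using u by (simp add: \<Phi>_def sum_nonneg less_imp_le)
    have s: "0 < s" using \<Phi>[of n] by (simp add: s_def)
    have ts: "t \<le> s" using u[of n] by (simp add: s_def t_def \<Phi>_def less_imp_le)
    have pF: "P n (Suc n) * F n = 1 / u n" by (simp add: u_def)
    \<comment> \<open>Downward moves involve only weights at most \<open>t\<close>, whereas the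
      up-step carries \<open>s\<close>; the recursion for \<open>F\<close> cancels everything but
      the gap \<open>s - t\<close>.\<close>
    have "(\<Sum>j<n. lower_sum P j n * w j) \<le> (\<Sum>j<n. lower_sum P j n * F j * t)"
    proof (rule sum_mono)
      fix j assume "j \<in> {..<n}"
      then have "\<Phi> (Suc j) \<le> \<Phi> n"
        unfolding \<Phi>_def using u by (intro sum_mono2) (auto intro: less_imp_le)
      then have "w j \<le> F j * t" using F[of j] by (simp add: w_def t_def)
      moreover have "0 \<le> lower_sum P j n" by (simp add: lower_sum_def sum_nonneg nonneg)
      ultimately show "lower_sum P j n * w j \<le> lower_sum P j n * F j * t"
        by (simp add: mult_left_mono mult.assoc)
    qed
    also have "\<dots> = P n (Suc n) * F n * t"
    proof (cases "n = 0")
      case True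
      then show ?thesis by (simp add: t_def \<Phi>_def)
    next
      case False
      then show ?thesis
        using lower_sum_F_seq[of n P] up[of n] by (simp add: F_def flip: sum_distrib_right)
    qed
    finally have "(\<Sum>j<n. lower_sum P j n * w j) - P n (Suc n) * w n \<le> - ((s - t) / u n)"
      using pF by (simp add: w_def s_def diff_divide_distrib flip: mult.assoc)
    moreover have "1 / (2 * s) \<le> (s - t) / u n"
    proof -
      have "s * s = \<Phi> n + u n" "t * t = \<Phi> n"
        using \<Phi>n \<Phi>[of n] by (simp_all add: s_def t_def) (simp add: \<Phi>_def)
      then have "u n = (s - t) * (s + t)" by (simp add: algebra_simps)
      also have "\<dots> \<le> (s - t) * (2 * s)" using ts by (intro mult_left_mono) auto
      finally show ?thesis using u[of n] s by (simp add: field_simps)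
    qed
    \<comment> \<open>The factor 2 from \<open>s + t \<le> 2 * s\<close> and the 2 in the Hardy
      bound combine to the constant \<open>4 * \<sigma>\<close>.\<close>
    moreover have "V n / (4 * \<sigma>) \<le> 1 / (2 * s)"
      using Vle[of n] s s0 by (simp add: s_def field_simps)
    moreover have "(\<Sum>k\<le>Suc n. P n k) = 1"
      using assms(1,3) by (rule row_sum_skip_free)
    ultimately show ?thesis
      using skip_free_drift[of P n V w, OF _ Vrec] by (simp add: left_diff_distrib)
  qed
  show ?thesis
    using geometrically_transient_if_superharmonic[OF nonneg assms(2,3) V _ drift] s0 by simp
qed

end
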